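(* In the landscape of determinantal singularities, $\overline{\Sigma}_r\subset\mathrm{Hom}(\mathbb{C}^n,\mathbb{C}^{n+k})$ is a stable singularity; that is, $JM(\overline{\Sigma}_r)=N_D(\overline{\Sigma}_r)$.
   Context: $\overline{\Sigma}_r$ is the set of $(n+k)\times n$ matrices with kernel of dimension at least $r$; its ideal is generated by the minors of size $n-r+1$ of the generic matrix $ID=(x_{i,j})$, $x_{i,j}$ being the coordinates on $\mathrm{Hom}(\mathbb{C}^n,\mathbb{C}^{n+k})\cong\mathbb{C}^{n(n+k)}$. In the landscape of determinantal singularities, a determinantal singularity $X$ comes with a presentation matrix $M_X$ whose minors of a given size generate the ideal of $X$ (and $X$ has the expected dimension); the allowable deformations are those induced by deforming the entries of $M_X$. The determinantal normal module $N_D(X)$ is the $\mathcal{O}_X$-module of first order infinitesimal deformations of $X$ coming from deformations of $M_X$: a matrix of generators has one column for each position $(i,j)$ of the matrix, namely the column vector consisting of the coefficients of $t$ in the defining minors of $M_X+t\delta_{i,j}$, where $\delta_{i,j}$ is the matrix with $1$ in position $(i,j)$ and $0$ elsewhere. $JM(X)$ is the $\mathcal{O}_X$-module generated by the (columns of) partial derivatives of the same defining minors. A singularity is stable (in this landscape) if its Jacobian module equals its module of infinitesimal deformations. *)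

theory Defs
  imports
    "HOL-Analysis.Analysis"
    "HOL-Algebra.QuotRing"
    "HOL-Algebra.Module"
    "Jordan_Normal_Form.Determinant"
begin

no_notation Matrix.vec_index (infixl "$" 100)

section \<open>Local rings of complex analytic spaces\<close>

text \<open>
  Holomorphy in several variables: Frechet differentiability with complex linear
  derivative, on a neighbourhood of the point.
\<close>

definition holomorphic_near :: "(complex^'q::finite \<Rightarrow> complex) \<Rightarrow> complex^'q \<Rightarrow> bool" where
  "holomorphic_near f p \<longleftrightarrow>
     (\<forall>\<^sub>F x in nhds p. \<exists>D. (f has_derivative D) (at x) \<and> (\<forall>c v. D (c *s v) = c * D v))"

definition hol_ring :: "complex^'q::finite \<Rightarrow> (complex^'q \<Rightarrow> complex) ring" where
  "hol_ring p = \<lparr>carrier = {f. holomorphic_near f p},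
     mult = (\<lambda>f g x. f x * g x), one = (\<lambda>_. 1), zero = (\<lambda>_. 0), add = (\<lambda>f g x. f x + g x)\<rparr>"

text \<open>
  Elements of \<open>hol_ring p\<close> are functions, not germs. The passage to germs happens in the
  quotient below, because the ideal of a set contains every function that vanishes near the
  point. Hence \<open>local_ring p (ideal_of X p)\<close> is the ring of germs at \<open>p\<close> of
  holomorphic functions modulo the germs vanishing on \<open>X\<close>.
\<close>

definition ideal_of :: "(complex^'q::finite) set \<Rightarrow> complex^'q \<Rightarrow> (complex^'q \<Rightarrow> complex) set" where
  "ideal_of X p = {f. holomorphic_near f p \<and> (\<forall>\<^sub>F x in nhds p. x \<in> X \<longrightarrow> f x = 0)}"

abbreviation local_ring ::
    "complex^'q::finite \<Rightarrow> (complex^'q \<Rightarrow> complex) set \<Rightarrow> (complex^'q \<Rightarrow> complex) set ring" where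
  "local_ring p I \<equiv> hol_ring p Quot I"


section \<open>Free modules and submodules generated by a finite family\<close>

text \<open>
  The fields \<open>mult\<close> and \<open>one\<close> are inherited from the ring record and play no role
  for modules.
\<close>

definition free_module :: "('a, 'b) ring_scheme \<Rightarrow> 'i set \<Rightarrow> ('a, 'i \<Rightarrow> 'a) module" where
  "free_module R B = \<lparr>carrier = B \<rightarrow>\<^sub>E carrier R,
     mult = (\<lambda>u v. \<lambda>b\<in>B. u b \<otimes>\<^bsub>R\<^esub> v b), one = (\<lambda>b\<in>B. \<one>\<^bsub>R\<^esub>),
     zero = (\<lambda>b\<in>B. \<zero>\<^bsub>R\<^esub>), add = (\<lambda>u v. \<lambda>b\<in>B. u b \<oplus>\<^bsub>R\<^esub> v b),
     smult = (\<lambda>a v. \<lambda>b\<in>B. a \<otimes>\<^bsub>R\<^esub> v b)\<rparr>"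

definition submodule_generated ::
    "('a, 'b) ring_scheme \<Rightarrow> ('a, 'c, 'd) module_scheme \<Rightarrow> ('j::finite \<Rightarrow> 'c) \<Rightarrow> 'c set" where
  "submodule_generated R M g =
     {(\<Oplus>\<^bsub>M\<^esub>j\<in>UNIV. a j \<odot>\<^bsub>M\<^esub> g j) | a. a \<in> UNIV \<rightarrow> carrier R}"


section \<open>Minors\<close>

text \<open>
  Rows are indexed by \<open>'m\<close> and columns by \<open>'n\<close>; the linear orders on the index types
  fix the order in which the selected rows and columns are listed.
\<close>

definition minor ::
    "'m::{finite,linorder} set \<times> 'n::{finite,linorder} set \<Rightarrow>
     'a::comm_ring_1^'n::{finite,linorder}^'m::{finite,linorder} \<Rightarrow> 'a" where
  "minor = (\<lambda>(I, J) A. Determinant.det (Matrix.mat (card I) (card J)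
     (\<lambda>(a, b). A $ (sorted_list_of_set I ! a) $ (sorted_list_of_set J ! b))))"

definition minor_indices :: "nat \<Rightarrow> ('m::finite set \<times> 'n::finite set) set" where
  "minor_indices s = {(I, J). card I = s \<and> card J = s}"


section \<open>Determinantal singularities\<close>

text \<open>
  A determinantal singularity at \<open>p\<close> is given by its ideal \<open>I\<close> in
  \<open>hol_ring p\<close>, a presentation matrix \<open>M\<close> of holomorphic functions, and
  the size \<open>s\<close> of the minors of \<open>M\<close> that generate the ideal. Both modules below are
  submodules of the free module over the local ring with one component for each such minor.
  The definitions do not enforce that the minors generate \<open>I\<close>. For the generic variety
  \<open>Sigma_bar r\<close> the ideal will be the full ideal of germs vanishing on it, which is the
  one generated by the minors of size \<open>n - r + 1\<close> of the generic matrix.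
\<close>

definition partial_deriv :: "'q::finite \<Rightarrow> (complex^'q \<Rightarrow> complex) \<Rightarrow> complex^'q \<Rightarrow> complex" where
  "partial_deriv q f x = deriv (\<lambda>t. f (x + t *s axis q 1)) 0"

definition class_column ::
    "complex^'q::finite \<Rightarrow> (complex^'q \<Rightarrow> complex) set \<Rightarrow> 'i set \<Rightarrow> ('i \<Rightarrow> complex^'q \<Rightarrow> complex) \<Rightarrow>
     'i \<Rightarrow> (complex^'q \<Rightarrow> complex) set" where
  "class_column p I B v = (\<lambda>b\<in>B. I +>\<^bsub>hol_ring p\<^esub> v b)"

definition jacobian_module ::
    "complex^'q::finite \<Rightarrow> (complex^'q \<Rightarrow> complex) set \<Rightarrow>
     (complex^'q \<Rightarrow> complex^'n::{finite,linorder}^'m::{finite,linorder}) \<Rightarrow> nat \<Rightarrow>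
     ('m set \<times> 'n set \<Rightarrow> (complex^'q \<Rightarrow> complex) set) set" where
  "jacobian_module p I M s =
     submodule_generated (local_ring p I) (free_module (local_ring p I) (minor_indices s))
       (\<lambda>q. class_column p I (minor_indices s) (\<lambda>b. partial_deriv q (\<lambda>x. minor b (M x))))"

text \<open>
  The matrix \<open>A + t \<delta>\<^sub>i\<^sub>j\<close>, whose entries are polynomials in \<open>t\<close>.
\<close>

definition perturb :: "'a::comm_ring_1^'n^'m \<Rightarrow> 'm \<times> 'n \<Rightarrow> 'a poly^'n^'m" where
  "perturb A = (\<lambda>(i, j). \<chi> k l. [: A $ k $ l, if k = i \<and> l = j then 1 else 0 :])"

definition determinantal_normal_module ::
    "complex^'q::finite \<Rightarrow> (complex^'q \<Rightarrow> complex) set \<Rightarrow>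
     (complex^'q \<Rightarrow> complex^'n::{finite,linorder}^'m::{finite,linorder}) \<Rightarrow> nat \<Rightarrow>
     ('m set \<times> 'n set \<Rightarrow> (complex^'q \<Rightarrow> complex) set) set" where
  "determinantal_normal_module p I M s =
     submodule_generated (local_ring p I) (free_module (local_ring p I) (minor_indices s))
       (\<lambda>ij. class_column p I (minor_indices s)
          (\<lambda>b x. poly.coeff (minor b (perturb (M x) ij)) 1))"

definition stable_determinantal ::
    "complex^'q::finite \<Rightarrow> (complex^'q \<Rightarrow> complex) set \<Rightarrow>
     (complex^'q \<Rightarrow> complex^'n::{finite,linorder}^'m::{finite,linorder}) \<Rightarrow> nat \<Rightarrow> bool" where
  "stable_determinantal p I M s \<longleftrightarrow>
     jacobian_module p I M s = determinantal_normal_module p I M s"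


section \<open>Generic determinantal varieties\<close>

text \<open>
  Points of \<open>complex^('m \<times> 'n)\<close> are the coordinate vectors \<open>(x\<^sub>i\<^sub>j)\<close> of linear maps
  from \<open>complex^'n\<close> to \<open>complex^'m\<close>, so \<open>n = CARD('n)\<close> and
  \<open>n + k = CARD('m)\<close>.
\<close>

definition generic_matrix :: "complex^('m::finite \<times> 'n::finite) \<Rightarrow> complex^'n^'m" where
  "generic_matrix x = (\<chi> i j. x $ (i, j))"

definition Sigma_bar :: "nat \<Rightarrow> (complex^('m::finite \<times> 'n::finite)) set" where
  "Sigma_bar r = {x. r \<le> vec.dim {v. generic_matrix x *v v = 0}}"


section \<open>The local rings are rings and the free modules are modules\<close>

lemma holomorphic_near_const: "holomorphic_near (\<lambda>_. c) p"
  unfolding holomorphic_near_def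
  by (rule always_eventually) (auto intro!: exI[of _ "\<lambda>_. 0"])

lemma holomorphic_near_add:
  assumes "holomorphic_near f p" "holomorphic_near g p"
  shows "holomorphic_near (\<lambda>x. f x + g x) p"
  using assms unfolding holomorphic_near_def
proof eventually_elim
  case (elim x)
  then obtain D E where "(f has_derivative D) (at x)" "\<forall>c v. D (c *s v) = c * D v"
    "(g has_derivative E) (at x)" "\<forall>c v. E (c *s v) = c * E v" by blast
  then show ?case
    by (intro exI[of _ "\<lambda>v. D v + E v"]) (auto intro: has_derivative_add simp: algebra_simps)
qed

lemma holomorphic_near_mult:
  assumes "holomorphic_near f p" "holomorphic_near g p"
  shows "holomorphic_near (\<lambda>x. f x * g x) p"
  using assms unfolding holomorphic_near_def
proof eventually_elim
  case (elim x)
  then obtain D E where "(f has_derivative D) (at x)" "\<forall>c v. D (c *s v) = c * D v"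
    "(g has_derivative E) (at x)" "\<forall>c v. E (c *s v) = c * E v" by blast
  then show ?case
    by (intro exI[of _ "\<lambda>v. f x * E v + D v * g x"] conjI has_derivative_mult)
      (auto simp: algebra_simps)
qed

lemma hol_ring_simps [simp]:
  "carrier (hol_ring p) = {f. holomorphic_near f p}"
  "f \<otimes>\<^bsub>hol_ring p\<^esub> g = (\<lambda>x. f x * g x)" "\<one>\<^bsub>hol_ring p\<^esub> = (\<lambda>_. 1)"
  "f \<oplus>\<^bsub>hol_ring p\<^esub> g = (\<lambda>x. f x + g x)" "\<zero>\<^bsub>hol_ring p\<^esub> = (\<lambda>_. 0)"
  by (auto simp: hol_ring_def)

lemma cring_hol_ring: "cring (hol_ring p)"
proof (rule cringI)
  show "abelian_group (hol_ring p)"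
  proof (rule abelian_groupI)
    fix f assume "f \<in> carrier (hol_ring p)"
    then have "holomorphic_near (\<lambda>x. (-1) * f x) p"
      by (intro holomorphic_near_mult holomorphic_near_const) auto
    then show "\<exists>g\<in>carrier (hol_ring p). g \<oplus>\<^bsub>hol_ring p\<^esub> f = \<zero>\<^bsub>hol_ring p\<^esub>"
      by (intro bexI[of _ "\<lambda>x. (-1) * f x"]) auto
  qed (auto simp: algebra_simps intro: holomorphic_near_const holomorphic_near_add)
  show "comm_monoid (hol_ring p)"
    by (rule comm_monoidI)
      (auto simp: algebra_simps intro: holomorphic_near_const holomorphic_near_mult)
qed (auto simp: algebra_simps)

lemma ideal_ideal_of: "ideal (ideal_of X p) (hol_ring p)"
proof -
  interpret cring "hol_ring p" by (rule cring_hol_ring)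
  have mult: "(\<lambda>x. g x * f x) \<in> ideal_of X p" if "f \<in> ideal_of X p" "holomorphic_near g p" for f g
    using that by (auto simp: ideal_of_def intro: holomorphic_near_mult elim!: eventually_mono)
  show ?thesis
  proof (rule idealI[OF ring_axioms])
    show "subgroup (ideal_of X p) (add_monoid (hol_ring p))"
    proof (rule add.subgroupI)
      show "ideal_of X p \<subseteq> carrier (hol_ring p)" by (auto simp: ideal_of_def)
      have "(\<lambda>_. 0) \<in> ideal_of X p" by (auto simp: ideal_of_def holomorphic_near_const)
      then show "ideal_of X p \<noteq> {}" by blast
    next
      fix f assume f: "f \<in> ideal_of X p"
      then have hf: "holomorphic_near f p" by (simp add: ideal_of_def)
      have m: "(\<lambda>x. (-1) * f x) \<in> ideal_of X p" by (rule mult[OF f holomorphic_near_const])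
      have "\<ominus>\<^bsub>hol_ring p\<^esub> f = (\<lambda>x. (-1) * f x)"
        by (rule minus_equality) (use hf m in \<open>auto simp: ideal_of_def\<close>)
      with m show "\<ominus>\<^bsub>hol_ring p\<^esub> f \<in> ideal_of X p" by simp
    next
      fix f g assume "f \<in> ideal_of X p" "g \<in> ideal_of X p"
      then show "f \<oplus>\<^bsub>hol_ring p\<^esub> g \<in> ideal_of X p"
        by (auto simp: ideal_of_def intro: holomorphic_near_add elim: eventually_elim2)
    qed
  qed (use mult in \<open>auto simp: mult.commute\<close>)
qed

lemma cring_local_ring: "cring (local_ring p (ideal_of X p))"
  by (rule ideal.quotient_is_cring[OF ideal_ideal_of cring_hol_ring])

lemma free_module_simps:
  "carrier (free_module R B) = B \<rightarrow>\<^sub>E carrier R" "\<zero>\<^bsub>free_module R B\<^esub> = (\<lambda>b\<in>B. \<zero>\<^bsub>R\<^esub>)"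
  "u \<oplus>\<^bsub>free_module R B\<^esub> v = (\<lambda>b\<in>B. u b \<oplus>\<^bsub>R\<^esub> v b)"
  "a \<odot>\<^bsub>free_module R B\<^esub> v = (\<lambda>b\<in>B. a \<otimes>\<^bsub>R\<^esub> v b)"
  by (simp_all add: free_module_def)

lemma module_free_module:
  assumes "cring R"
  shows "module R (free_module R B)"
proof -
  interpret cring R by (rule assms)
  have cl: "(\<lambda>b\<in>B. f b) \<in> B \<rightarrow>\<^sub>E carrier R" if "\<And>b. b \<in> B \<Longrightarrow> f b \<in> carrier R" for f
    using that by simp
  have mem: "u b \<in> carrier R" if "u \<in> B \<rightarrow>\<^sub>E carrier R" "b \<in> B" for u b
    using that by (rule PiE_mem)
  have unit: "(\<lambda>b\<in>B. f b) = u" if "u \<in> B \<rightarrow>\<^sub>E carrier R" "\<And>b. b \<in> B \<Longrightarrow> f b = u b" for f u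
    using that PiE_arb[OF that(1)] by (simp add: restrict_def fun_eq_iff)
  show ?thesis
  proof (rule moduleI[OF assms])
    show "abelian_group (free_module R B)"
    proof (rule abelian_groupI, unfold free_module_simps)
      fix u assume u: "u \<in> B \<rightarrow>\<^sub>E carrier R"
      show "(\<lambda>b\<in>B. (\<lambda>b\<in>B. \<zero>\<^bsub>R\<^esub>) b \<oplus>\<^bsub>R\<^esub> u b) = u"
        by (rule unit[OF u]) (simp add: mem[OF u])
      show "\<exists>v\<in>B \<rightarrow>\<^sub>E carrier R. (\<lambda>b\<in>B. v b \<oplus>\<^bsub>R\<^esub> u b) = (\<lambda>b\<in>B. \<zero>\<^bsub>R\<^esub>)"
      proof
        show "(\<lambda>b\<in>B. \<ominus>\<^bsub>R\<^esub> u b) \<in> B \<rightarrow>\<^sub>E carrier R"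
          by (rule cl) (simp add: mem[OF u])
        show "(\<lambda>b\<in>B. (\<lambda>b\<in>B. \<ominus>\<^bsub>R\<^esub> u b) b \<oplus>\<^bsub>R\<^esub> u b) = (\<lambda>b\<in>B. \<zero>\<^bsub>R\<^esub>)"
          by (rule restrict_ext) (simp add: mem[OF u] l_neg)
      qed
    next
      fix u v assume u: "u \<in> B \<rightarrow>\<^sub>E carrier R" and v: "v \<in> B \<rightarrow>\<^sub>E carrier R"
      show "(\<lambda>b\<in>B. u b \<oplus>\<^bsub>R\<^esub> v b) \<in> B \<rightarrow>\<^sub>E carrier R"
        by (rule cl) (simp add: mem[OF u] mem[OF v])
      show "(\<lambda>b\<in>B. u b \<oplus>\<^bsub>R\<^esub> v b) = (\<lambda>b\<in>B. v b \<oplus>\<^bsub>R\<^esub> u b)"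
        by (rule restrict_ext) (simp add: mem[OF u] mem[OF v] a_comm)
      fix w assume w: "w \<in> B \<rightarrow>\<^sub>E carrier R"
      show "(\<lambda>b\<in>B. (\<lambda>b\<in>B. u b \<oplus>\<^bsub>R\<^esub> v b) b \<oplus>\<^bsub>R\<^esub> w b) =
            (\<lambda>b\<in>B. u b \<oplus>\<^bsub>R\<^esub> (\<lambda>b\<in>B. v b \<oplus>\<^bsub>R\<^esub> w b) b)"
        by (rule restrict_ext) (simp add: mem[OF u] mem[OF v] mem[OF w] a_assoc)
    qed (rule cl, simp)
  next
    fix a u assume a: "a \<in> carrier R" and "u \<in> carrier (free_module R B)"
    then have u: "u \<in> B \<rightarrow>\<^sub>E carrier R" by (simp only: free_module_simps)
    show "a \<odot>\<^bsub>free_module R B\<^esub> u \<in> carrier (free_module R B)"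
      unfolding free_module_simps by (rule cl) (simp add: a mem[OF u])
    fix b assume b: "b \<in> carrier R"
    show "(a \<oplus>\<^bsub>R\<^esub> b) \<odot>\<^bsub>free_module R B\<^esub> u =
        a \<odot>\<^bsub>free_module R B\<^esub> u \<oplus>\<^bsub>free_module R B\<^esub> b \<odot>\<^bsub>free_module R B\<^esub> u"
      unfolding free_module_simps by (rule restrict_ext) (simp add: a b mem[OF u] l_distr)
    show "(a \<otimes>\<^bsub>R\<^esub> b) \<odot>\<^bsub>free_module R B\<^esub> u =
        a \<odot>\<^bsub>free_module R B\<^esub> (b \<odot>\<^bsub>free_module R B\<^esub> u)"
      unfolding free_module_simps by (rule restrict_ext) (simp add: a b mem[OF u] m_assoc)
  next
    fix a u v assume a: "a \<in> carrier R"
      and "u \<in> carrier (free_module R B)" "v \<in> carrier (free_module R B)"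
    then have u: "u \<in> B \<rightarrow>\<^sub>E carrier R" and v: "v \<in> B \<rightarrow>\<^sub>E carrier R"
      by (simp_all only: free_module_simps)
    show "a \<odot>\<^bsub>free_module R B\<^esub> (u \<oplus>\<^bsub>free_module R B\<^esub> v) =
        a \<odot>\<^bsub>free_module R B\<^esub> u \<oplus>\<^bsub>free_module R B\<^esub> a \<odot>\<^bsub>free_module R B\<^esub> v"
      unfolding free_module_simps
      by (rule restrict_ext) (simp add: a mem[OF u] mem[OF v] r_distr)
  next
    fix u assume "u \<in> carrier (free_module R B)"
    then have u: "u \<in> B \<rightarrow>\<^sub>E carrier R" by (simp only: free_module_simps)
    show "\<one>\<^bsub>R\<^esub> \<odot>\<^bsub>free_module R B\<^esub> u = u"
      unfolding free_module_simps by (rule unit[OF u]) (simp add: mem[OF u])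
  qed
qed

end

theory Submission
  imports Defs
begin

text \<open>
  The entries of the generic matrix are the coordinates themselves, so moving a point \<open>x\<close>
  along the coordinate axis \<open>(i, j)\<close> replaces the matrix \<open>generic_matrix x\<close> by
  \<open>generic_matrix x + t \<delta>\<^sub>i\<^sub>j\<close>. A minor along this line is the polynomial in
  \<open>t\<close> that the determinantal normal module uses, evaluated at \<open>t\<close>
  (\<open>minor_generic_matrix_line\<close>); its derivative at \<open>0\<close> is the coefficient of
  \<open>t\<close>. Hence the Jacobian module and the determinantal normal module have the same
  generators, as functions and not only modulo the ideal of the variety. The geometric
  point is that every constant perturbation of the entries is a translation of the coordinates.
\<close>

text \<open>Minors are polynomials in the entries with integer coefficients.\<close>

lemma minor_hom:
  fixes h :: "'a::comm_ring_1 \<Rightarrow> 'b::comm_ring_1"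
  assumes "comm_ring_hom h"
  shows "minor b (\<chi> k l. h (C $ k $ l)) = h (minor b C)"
proof -
  interpret comm_ring_hom h by (rule assms)
  obtain I J where b: "b = (I, J)"
    by (cases b)
  have "minor b (\<chi> k l. h (C $ k $ l)) =
      Determinant.det (map_mat h (Matrix.mat (card I) (card J)
        (\<lambda>(a, b). C $ (sorted_list_of_set I ! a) $ (sorted_list_of_set J ! b))))"
    unfolding b minor_def prod.case
    by (rule arg_cong[where f = Determinant.det], rule eq_matI) simp_all
  also have "\<dots> = h (minor b C)"
    unfolding b minor_def prod.case by (rule hom_det)
  finally show ?thesis .
qed

lemma minor_generic_matrix_line:
  "minor b (generic_matrix (x + t *s axis ij 1)) =
     poly (minor b (perturb (generic_matrix x) ij)) t"
proof -
  have "comm_ring_hom (\<lambda>p. poly p t)"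
    by unfold_locales auto
  note minor_hom[OF this, of b "perturb (generic_matrix x) ij"]
  moreover have "generic_matrix (x + t *s axis ij 1) =
      (\<chi> k l. poly (perturb (generic_matrix x) ij $ k $ l) t)"
    by (cases ij) (simp add: generic_matrix_def perturb_def vec_eq_iff axis_def)
  ultimately show ?thesis
    by simp
qed

lemma deriv_poly_0: "deriv (poly p) 0 = poly.coeff p 1"
proof -
  have "deriv (poly p) 0 = poly (pderiv p) 0"
    by (rule DERIV_imp_deriv) (rule poly_DERIV)
  then show ?thesis
    by (simp add: poly_0_coeff_0 coeff_pderiv)
qed

lemma partial_deriv_minor_generic_matrix:
  "partial_deriv ij (\<lambda>x. minor b (generic_matrix x)) =
     (\<lambda>x. poly.coeff (minor b (perturb (generic_matrix x) ij)) 1)"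
  by (simp add: fun_eq_iff partial_deriv_def minor_generic_matrix_line deriv_poly_0)

theorem proposition3p3:
  fixes r :: nat
    and A :: "complex^('m::{finite,linorder} \<times> 'n::{finite,linorder})"
  assumes "A \<in> Sigma_bar r"
  shows "stable_determinantal A (ideal_of (Sigma_bar r) A)
           (generic_matrix :: complex^('m \<times> 'n) \<Rightarrow> complex^'n::{finite,linorder}^'m::{finite,linorder}) (CARD('n) + 1 - r)"
  unfolding stable_determinantal_def jacobian_module_def determinantal_normal_module_def
    partial_deriv_minor_generic_matrix ..

end
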